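(* Fix $\delta,\alpha_0\in(0,1)$. Let $\mathbf{Y}=(\mathbf{Y}^1,\dots,\mathbf{Y}^n)$ be a sample of i.i.d. integrable random vectors in $\mathbb{R}^K$ with mean $\mu$, whose distribution is symmetric about $\mu$: $(\mathbf{Y}^i-\mu)\sim(\mu-\mathbf{Y}^i)$. Let $f:(\mathbb{R}^K)^n\to[0,\infty)$ be a nonnegative function. Let $\phi:\mathbb{R}^K\to\mathbb{R}$ be a nonnegative, subadditive and positive homogeneous function, and define $\widetilde{\phi}(x):=\max(\phi(x),\phi(-x))$. Then $$\mathbb{P}\big(\phi(\overline{\mathbf{Y}}-\mu)>q_{\alpha_0(1-\delta)}(\phi,\mathbf{Y}-\overline{\mathbf{Y}})+\gamma_1(\alpha_0\delta)f(\mathbf{Y})\big)\le\alpha_0+\mathbb{P}\big(\widetilde{\phi}(\overline{\mathbf{Y}}-\mu)>f(\mathbf{Y})\big),$$ where $\gamma_1(\eta):=\frac{2\overline{\mathcal{B}}(n,\eta/2)-n}{n}$ and $\overline{\mathcal{B}}(n,\eta):=\max\big\{k\in\{0,\dots,n\}\,\big|\,2^{-n}\sum_{i=k}^n\binom{n}{i}\ge\eta\big\}$ is the upper quantile function of a Binomial$(n,\frac12)$ variable.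
   Context: $K\ge1$ and $n\ge2$ are integers. $\overline{\mathbf{Y}}=\frac1n\sum_{i=1}^n\mathbf{Y}^i$; $\mathbf{Y}-\overline{\mathbf{Y}}$ denotes the $K\times n$ matrix with columns $\mathbf{Y}^i-\overline{\mathbf{Y}}$. For $w\in\mathbb{R}^n$ and a $K\times n$ matrix $\mathbf{X}$ with columns $\mathbf{X}^i$, $\overline{\mathbf{X}}^{\langle w\rangle}=\frac1n\sum_{i=1}^nw_i\mathbf{X}^i$. Let $W=(W_1,\dots,W_n)$ be a vector of i.i.d. Rademacher variables ($\mathbb{P}(W_i=1)=\mathbb{P}(W_i=-1)=1/2$) independent of $\mathbf{Y}$, and let $\mathbb{P}_W$ be the probability over $W$ only. The resampled quantile is $$q_\alpha(\phi,\mathbf{X}):=\inf\{x\in\mathbb{R}\mid\mathbb{P}_W(\phi(\overline{\mathbf{X}}^{\langle W\rangle})>x)\le\alpha\}.$$ Subadditive means $\phi(x+x')\le\phi(x)+\phi(x')$; positive homogeneous means $\phi(\lambda x)=\lambda\phi(x)$ for all $\lambda\in\mathbb{R}^+$. *)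

theory Defs
  imports "HOL-Probability.Probability"
begin

(* A sample (X^1, ..., X^n) of vectors in R^K, i.e. a K x n matrix given by its columns,
   is a value X :: real^'k^'n with K = CARD('k), n = CARD('n) and i-th column X $ i. *)

definition wmean :: "real^'n \<Rightarrow> real^'k^'n \<Rightarrow> real^'k" where
  "wmean w X = (1 / real CARD('n)) *\<^sub>R (\<Sum>i\<in>UNIV. (w $ i) *\<^sub>R (X $ i))"

definition emp_mean :: "real^'k^'n \<Rightarrow> real^'k" where
  "emp_mean X = (1 / real CARD('n)) *\<^sub>R (\<Sum>i\<in>UNIV. X $ i)"

definition centered :: "real^'k^'n \<Rightarrow> real^'k^'n" where
  "centered X = (\<chi> i. X $ i - emp_mean X)"

definition rademacher_pmf :: "real pmf" where
  "rademacher_pmf = pmf_of_set {1, -1}"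

(* The law of W = (W_1, ..., W_n). As W is independent of the data, the probability over
   W only, with the data held fixed, is probability under this law. *)
definition rademacher_vec_pmf :: "(real^'n) pmf" where
  "rademacher_vec_pmf = map_pmf vec_lambda (Pi_pmf UNIV 0 (\<lambda>_. rademacher_pmf))"

definition resampled_quantile :: "real \<Rightarrow> (real^'k \<Rightarrow> real) \<Rightarrow> real^'k^'n \<Rightarrow> real" where
  "resampled_quantile \<alpha> \<phi> X =
     Inf {x. measure_pmf.prob rademacher_vec_pmf {w. \<phi> (wmean w X) > x} \<le> \<alpha>}"

definition subadditive_fun :: "('v::real_vector \<Rightarrow> real) \<Rightarrow> bool" where
  "subadditive_fun \<phi> \<longleftrightarrow> (\<forall>x y. \<phi> (x + y) \<le> \<phi> x + \<phi> y)"

definition pos_homogeneous :: "('v::real_vector \<Rightarrow> real) \<Rightarrow> bool" where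
  "pos_homogeneous \<phi> \<longleftrightarrow> (\<forall>c\<ge>0. \<forall>x. \<phi> (c *\<^sub>R x) = c * \<phi> x)"

definition sym_max :: "('v::real_vector \<Rightarrow> real) \<Rightarrow> 'v \<Rightarrow> real" where
  "sym_max \<phi> x = max (\<phi> x) (\<phi> (- x))"

(* For \<eta> \<le> 1 the set contains 0, so that the maximum is a genuine one. *)
definition binom_upper_quantile :: "nat \<Rightarrow> real \<Rightarrow> nat" where
  "binom_upper_quantile n \<eta> =
     Max {k \<in> {0..n}. (1 / 2) ^ n * (\<Sum>i=k..n. real (n choose i)) \<ge> \<eta>}"

definition gamma1 :: "nat \<Rightarrow> real \<Rightarrow> real" where
  "gamma1 n \<eta> = (2 * real (binom_upper_quantile n (\<eta> / 2)) - real n) / real n"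

end

theory Submission
  imports Defs
begin

text \<open>
  The proof compares the resampled quantile with an exact randomization test.

  Write \<open>S\<close> for the \<open>\<mu>\<close>-centred sample \<open>Y - \<mu>\<close>. As its columns are independent and symmetric, the law
  of \<open>S\<close> does not change when columns are multiplied by fixed signs. Hence the p-value of the sign-flip
  test, the conditional probability over \<open>W\<close> that \<open>\<phi> (wmean W S)\<close> reaches the observed
  \<open>\<phi> (emp_mean S)\<close>, is at most \<open>\<alpha>\<^sub>0\<close> with probability at most \<open>\<alpha>\<^sub>0\<close> (\<open>prob_flip_pvalue_le\<close>).
  This bound would be enough if \<open>\<mu>\<close> were known.

  The quantile is computed from the empirically centred data instead, and the difference is explicit:
  \<open>wmean W S\<close> is \<open>wmean W (centered Y)\<close> plus the mean of the signs times \<open>emp_mean Y - \<mu>\<close>. By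
  subadditivity and homogeneity, \<open>\<phi>\<close> of the last term is at most the absolute mean sign times
  \<open>sym_max \<phi> (emp_mean Y - \<mu>)\<close>, hence at most the absolute mean sign times \<open>f Y\<close> outside the
  exceptional event on the right-hand side. So \<open>\<phi> (wmean W S)\<close> can exceed
  \<open>q + \<gamma> * f Y\<close> only if \<open>\<phi> (wmean W (centered Y))\<close> exceeds its quantile \<open>q\<close>, which has conditional
  probability at most \<open>\<alpha>\<^sub>0 * (1 - \<delta>)\<close> (\<open>prob_gt_resampled_quantile_le\<close>), or the absolute mean sign exceeds
  \<open>\<gamma>\<close>, which has probability at most \<open>\<alpha>\<^sub>0 * \<delta>\<close> by the binomial tail (\<open>prob_abs_mean_sign_gt_gamma1\<close>).
  If \<open>\<phi> (emp_mean S)\<close> is itself above this threshold, the p-value is therefore at most \<open>\<alpha>\<^sub>0\<close>.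

  The argument goes through p-values rather than through the quantile of \<open>S\<close>: the p-value
  is a finite sum of indicators, so that its measurability is immediate.
\<close>

section \<open>The law of the random signs\<close>

definition sign_vectors :: "(real^'n) set" where
  "sign_vectors = {w. \<forall>i. w $ i \<in> {1, -1}}"

definition signs_of :: "'n set \<Rightarrow> real^'n" where
  "signs_of A = (\<chi> i. if i \<in> A then 1 else -1)"

lemma bij_betw_signs_of: "bij_betw signs_of UNIV (sign_vectors :: (real^'n) set)"
  by (rule bij_betwI[where g = "\<lambda>w. {i. w $ i = 1}"])
     (auto simp: signs_of_def sign_vectors_def vec_eq_iff)

lemma finite_sign_vectors [simp]: "finite (sign_vectors :: (real^'n) set)"
  using bij_betw_finite[OF bij_betw_signs_of] by simp

lemma sign_vectors_not_empty [simp]: "(sign_vectors :: (real^'n) set) \<noteq> {}"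
  using bij_betw_signs_of by (auto simp: bij_betw_def)

lemma rademacher_vec_pmf_eq: "rademacher_vec_pmf = pmf_of_set (sign_vectors :: (real^'n) set)"
proof -
  have "bij_betw vec_lambda (PiE_dflt UNIV 0 (\<lambda>_::'n. {1, -1::real})) (sign_vectors :: (real^'n) set)"
    by (rule bij_betwI[where g = vec_nth]) (auto simp: sign_vectors_def PiE_dflt_def)
  moreover have "Pi_pmf UNIV 0 (\<lambda>_::'n. rademacher_pmf)
      = pmf_of_set (PiE_dflt UNIV 0 (\<lambda>_::'n. {1, -1::real}))"
    unfolding rademacher_pmf_def by (subst Pi_pmf_of_set) auto
  ultimately show ?thesis
    unfolding rademacher_vec_pmf_def
    by (auto intro!: map_pmf_of_set_bij_betw finite_PiE_dflt simp: PiE_dflt_empty_iff)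
qed

lemma set_rademacher_vec_pmf [simp]: "set_pmf rademacher_vec_pmf = (sign_vectors :: (real^'n) set)"
  by (simp add: rademacher_vec_pmf_eq)

lemma map_times_rademacher_vec_pmf:
  fixes w :: "real^'n"
  assumes "w \<in> sign_vectors"
  shows "map_pmf (\<lambda>v. v * w) rademacher_vec_pmf = rademacher_vec_pmf"
proof -
  have "w $ i * w $ i = 1" for i
    using assms by (auto simp: sign_vectors_def dest!: spec[of _ i])
  then have "v * w * w = v" for v :: "real^'n"
    by (simp add: vec_eq_iff mult.assoc)
  moreover have "v * w \<in> sign_vectors" if "v \<in> sign_vectors" for v
  proof -
    have "v $ i * w $ i = 1 \<or> v $ i * w $ i = - 1" for i
      using assms that by (auto simp: sign_vectors_def dest!: spec[of _ i])
    then show ?thesis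
      by (simp add: sign_vectors_def)
  qed
  ultimately have "bij_betw (\<lambda>v. v * w) sign_vectors sign_vectors"
    by (intro bij_betwI[where g = "\<lambda>v. v * w"]) auto
  then show ?thesis
    unfolding rademacher_vec_pmf_eq by (intro map_pmf_of_set_bij_betw) auto
qed

lemma rademacher_vec_pmf_eq_map_signs_of:
  "rademacher_vec_pmf = map_pmf signs_of (pmf_of_set (UNIV :: 'n::finite set set))"
  unfolding rademacher_vec_pmf_eq
  by (rule map_pmf_of_set_bij_betw[symmetric]) (auto intro: bij_betw_signs_of)

lemma sum_signs_of:
  "(\<Sum>i\<in>UNIV. signs_of A $ i) = 2 * real (card A) - real CARD('n)" for A :: "'n::finite set"
proof -
  have "(\<Sum>i\<in>UNIV. signs_of A $ i) = real (card A) - real (card (- A))"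
    by (simp add: signs_of_def sum.If_cases Compl_eq)
  also have "card A + card (- A) = CARD('n)"
    using card_Un_disjoint[of A "- A"] by simp
  then have "real (card (- A)) = real CARD('n) - real (card A)"
    by linarith
  finally show ?thesis by simp
qed

lemma prob_sum_signs_gt:
  "measure_pmf.prob rademacher_vec_pmf {w::real^'n. (\<Sum>i\<in>UNIV. w $ i) > 2 * real k - real CARD('n)}
     = (1 / 2) ^ CARD('n) * (\<Sum>i=Suc k..CARD('n). real (CARD('n) choose i))"
proof -
  have layers: "{A::'n set. k < card A} = (\<Union>i\<in>{Suc k..CARD('n)}. {A. A \<subseteq> UNIV \<and> card A = i})"
    by (auto simp: card_mono Suc_le_eq)
  have "card {A::'n set. k < card A} = (\<Sum>i=Suc k..CARD('n). CARD('n) choose i)"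
    unfolding layers by (subst card_UN_disjoint) (auto simp: n_subsets[OF finite, of UNIV, simplified])
  then show ?thesis
    unfolding rademacher_vec_pmf_eq_map_signs_of
    by (simp add: measure_pmf_of_set vimage_def sum_signs_of card_UNIV_set
        power_divide flip: of_nat_sum)
qed

text \<open>
  The set whose maximum defines the upper quantile \<open>k\<close> does not contain \<open>k + 1\<close>. Thus each of the two
  one-sided tails beyond \<open>gamma1\<close> has probability at most \<open>\<eta> / 2\<close>; the sign symmetry of the law exchanges
  them.
\<close>

lemma prob_abs_mean_sign_gt_gamma1:
  assumes "\<eta> \<ge> 0"
  shows "measure_pmf.prob rademacher_vec_pmf
      {w::real^'n. \<bar>(\<Sum>i\<in>UNIV. w $ i) / real CARD('n)\<bar> > gamma1 CARD('n) \<eta>} \<le> \<eta>"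
proof -
  let ?R = "measure_pmf.prob (rademacher_vec_pmf :: (real^'n) pmf)"
  let ?S = "{k \<in> {0..CARD('n)}. (1 / 2) ^ CARD('n) * (\<Sum>i=k..CARD('n). real (CARD('n) choose i)) \<ge> \<eta> / 2}"
  define k where "k = binom_upper_quantile CARD('n) (\<eta> / 2)"
  define P where "P = {w::real^'n. (\<Sum>i\<in>UNIV. w $ i) > 2 * real k - real CARD('n)}"
  define N where "N = {w::real^'n. - (\<Sum>i\<in>UNIV. w $ i) > 2 * real k - real CARD('n)}"
  have "Suc k \<notin> ?S"
    using Max_ge[of ?S "Suc k"] unfolding k_def binom_upper_quantile_def by fastforce
  then have "(1 / 2) ^ CARD('n) * (\<Sum>i=Suc k..CARD('n). real (CARD('n) choose i)) \<le> \<eta> / 2"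
    using assms by (cases "Suc k \<le> CARD('n)") auto
  then have P: "?R P \<le> \<eta> / 2"
    unfolding P_def prob_sum_signs_gt .
  have "?R P = measure_pmf.prob (map_pmf (\<lambda>v. v * (- 1)) rademacher_vec_pmf) P"
    by (subst map_times_rademacher_vec_pmf) (auto simp: sign_vectors_def)
  also have "\<dots> = ?R N"
    by (simp add: P_def N_def vimage_def sum_negf)
  finally have N: "?R N \<le> \<eta> / 2"
    using P by simp
  have "{w::real^'n. \<bar>(\<Sum>i\<in>UNIV. w $ i) / real CARD('n)\<bar> > gamma1 CARD('n) \<eta>} \<subseteq> P \<union> N"
    by (auto simp: P_def N_def gamma1_def k_def abs_if divide_less_cancel minus_divide_left
        simp del: minus_divide_left[symmetric] split: if_splits)
  then have "?R {w::real^'n. \<bar>(\<Sum>i\<in>UNIV. w $ i) / real CARD('n)\<bar> > gamma1 CARD('n) \<eta>} \<le> ?R (P \<union> N)"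
    by (intro measure_pmf.finite_measure_mono) auto
  also have "\<dots> \<le> ?R P + ?R N"
    by (rule measure_Un_le) auto
  finally show ?thesis
    using P N by simp
qed

section \<open>Quantiles and p-values under a law of finite support\<close>

text \<open>
  The infimum defining a quantile is attained, since upper tail probabilities are right continuous.
  Finite support provides a threshold that is almost surely not exceeded. For \<open>\<alpha> \<ge> 1\<close> the infimum is
  a default value and the bound is trivial; the argument covers this case uniformly.
\<close>

lemma prob_gt_quantile_le:
  fixes g :: "'b \<Rightarrow> real"
  assumes fin: "finite (set_pmf p)" and \<alpha>: "0 \<le> \<alpha>"
  shows "measure_pmf.prob p {w. g w > Inf {x. measure_pmf.prob p {w. g w > x} \<le> \<alpha>}} \<le> \<alpha>"
proof -
  let ?T = "\<lambda>x. measure_pmf.prob p {w. g w > x}"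
  define q where "q = Inf {x. ?T x \<le> \<alpha>}"
  have "g w \<le> Max (g ` set_pmf p)" if "w \<in> set_pmf p" for w
    using fin that by simp
  then have "set_pmf p \<inter> {w. g w > Max (g ` set_pmf p)} = {}"
    by (meson disjoint_iff mem_Collect_eq not_le)
  then have "?T (Max (g ` set_pmf p)) = 0"
    by (simp add: measure_pmf_zero_iff)
  then have ne: "{x. ?T x \<le> \<alpha>} \<noteq> {}"
    using \<alpha> by (auto intro!: exI[of _ "Max (g ` set_pmf p)"])
  have tail: "?T x \<le> \<alpha>" if less: "q < x" for x
  proof -
    obtain y where y: "?T y \<le> \<alpha>" "y < x"
      using cInf_lessD[OF ne, of x] less unfolding q_def by blast
    have "?T x \<le> ?T y"
      using y(2) by (intro measure_pmf.finite_measure_mono) auto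
    with y(1) show ?thesis by simp
  qed
  have "(\<lambda>n. ?T (q + 1 / real (Suc n))) \<longlonglongrightarrow> measure_pmf.prob p (\<Union>n. {w. g w > q + 1 / real (Suc n)})"
  proof (rule measure_pmf.finite_Lim_measure_incseq)
    show "incseq (\<lambda>n. {w. g w > q + 1 / real (Suc n)})"
    proof (rule incseq_SucI, rule subsetI)
      fix n w assume "w \<in> {w. g w > q + 1 / real (Suc n)}"
      moreover have "1 / real (Suc (Suc n)) \<le> 1 / real (Suc n)"
        by (simp add: field_simps)
      ultimately show "w \<in> {w. g w > q + 1 / real (Suc (Suc n))}" by simp
    qed
  qed simp
  moreover have "(\<Union>n. {w. g w > q + 1 / real (Suc n)}) = {w. g w > q}"
  proof safe
    fix w n assume "g w > q + 1 / real (Suc n)"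
    moreover have "1 / real (Suc n) > 0" by simp
    ultimately show "g w > q" by linarith
  next
    fix w assume "g w > q"
    then obtain n where "inverse (real (Suc n)) < g w - q"
      using reals_Archimedean[of "g w - q"] by auto
    then show "w \<in> (\<Union>n. {w. g w > q + 1 / real (Suc n)})"
      by (auto simp: inverse_eq_divide intro!: exI[of _ n])
  qed
  ultimately have "(\<lambda>n. ?T (q + 1 / real (Suc n))) \<longlonglongrightarrow> ?T q" by simp
  then have "?T q \<le> \<alpha>"
    by (rule LIMSEQ_le_const2) (auto intro!: tail)
  then show ?thesis
    by (simp only: q_def)
qed

lemma prob_gt_resampled_quantile_le:
  fixes X :: "real^'k^'n"
  assumes "0 \<le> \<alpha>"
  shows "measure_pmf.prob rademacher_vec_pmf {w. \<phi> (wmean w X) > resampled_quantile \<alpha> \<phi> X} \<le> \<alpha>"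
  unfolding resampled_quantile_def
  using assms by (intro prob_gt_quantile_le[where g = "\<lambda>w. \<phi> (wmean w X)"]) simp_all

text \<open>
  This is why p-values are valid: the outcomes with p-value at most \<open>\<alpha>\<close> all score at least as
  high as the lowest-scoring one among them, whose p-value therefore bounds their probability.
\<close>

lemma prob_pvalue_le:
  fixes g :: "'b \<Rightarrow> real"
  assumes fin: "finite (set_pmf p)" and "0 \<le> \<alpha>"
  shows "measure_pmf.prob p {w. measure_pmf.prob p {v. g w \<le> g v} \<le> \<alpha>} \<le> \<alpha>"
proof -
  define T where "T = {w. measure_pmf.prob p {v. g w \<le> g v} \<le> \<alpha>}"
  show ?thesis
  proof (cases "set_pmf p \<inter> T = {}")
    case True
    then have "measure_pmf.prob p T = 0"
      by (simp add: measure_pmf_zero_iff)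
    then show ?thesis
      using assms by (simp add: T_def)
  next
    case False
    define w where "w = arg_min_on g (set_pmf p \<inter> T)"
    have "w \<in> T" and least: "\<And>v. v \<in> set_pmf p \<inter> T \<Longrightarrow> g w \<le> g v"
      using arg_min_if_finite[of "set_pmf p \<inter> T" g] False fin unfolding w_def
      by (auto simp: not_less)
    have "measure_pmf.prob p T = measure_pmf.prob p (set_pmf p \<inter> T)"
      by (simp add: Int_commute measure_Int_set_pmf)
    also have "\<dots> \<le> measure_pmf.prob p {v. g w \<le> g v}"
      using least by (intro measure_pmf.finite_measure_mono) auto
    also have "\<dots> \<le> \<alpha>"
      using \<open>w \<in> T\<close> by (simp add: T_def)
    finally show ?thesis
      by (simp add: T_def)
  qed
qed

section \<open>The sign-flip test for symmetric samples\<close>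

definition flip_signs :: "real^'n \<Rightarrow> real^'k^'n \<Rightarrow> real^'k^'n" where
  "flip_signs w X = (\<chi> i. w $ i *\<^sub>R X $ i)"

definition flip_pvalue :: "(real^'k \<Rightarrow> real) \<Rightarrow> real^'k^'n \<Rightarrow> real" where
  "flip_pvalue \<phi> X = measure_pmf.prob rademacher_vec_pmf {v. \<phi> (emp_mean X) \<le> \<phi> (wmean v X)}"

lemma emp_mean_flip_signs: "emp_mean (flip_signs w X) = wmean w X"
  by (simp add: emp_mean_def wmean_def flip_signs_def)

lemma wmean_flip_signs: "wmean v (flip_signs w X) = wmean (v * w) X"
  by (simp add: wmean_def flip_signs_def)

text \<open>
  Flipping the data by fixed signs leaves the resampling distribution unchanged, so only the observed
  statistic changes.
\<close>

lemma flip_pvalue_flip_signs: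
  assumes "w \<in> sign_vectors"
  shows "flip_pvalue \<phi> (flip_signs w X)
    = measure_pmf.prob rademacher_vec_pmf {v. \<phi> (wmean w X) \<le> \<phi> (wmean v X)}"
proof -
  have "measure_pmf.prob rademacher_vec_pmf {v. \<phi> (wmean w X) \<le> \<phi> (wmean v X)}
      = measure_pmf.prob (map_pmf (\<lambda>v. v * w) rademacher_vec_pmf) {v. \<phi> (wmean w X) \<le> \<phi> (wmean v X)}"
    by (simp add: map_times_rademacher_vec_pmf[OF assms])
  also have "\<dots> = flip_pvalue \<phi> (flip_signs w X)"
    by (simp add: flip_pvalue_def emp_mean_flip_signs wmean_flip_signs vimage_def)
  finally show ?thesis ..
qed

lemma borel_measurable_wmean [measurable]: "wmean w \<in> borel_measurable borel"
  unfolding wmean_def[abs_def] by (intro borel_measurable_continuous_onI continuous_intros)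

lemma borel_measurable_emp_mean [measurable]: "emp_mean \<in> borel_measurable borel"
  unfolding emp_mean_def[abs_def] by (intro borel_measurable_continuous_onI continuous_intros)

lemma borel_measurable_flip_signs [measurable]: "flip_signs w \<in> borel_measurable borel"
  unfolding flip_signs_def[abs_def] by (intro borel_measurable_continuous_onI continuous_intros)

lemma borel_measurable_flip_pvalue:
  assumes [measurable]: "\<phi> \<in> borel_measurable borel"
  shows "flip_pvalue \<phi> \<in> borel_measurable (borel :: (real^'k^'n) measure)"
proof -
  have "flip_pvalue \<phi> X = (\<Sum>v\<in>sign_vectors.
      indicator {X. \<phi> (emp_mean X) \<le> \<phi> (wmean v X)} X * pmf rademacher_vec_pmf v)"
    for X :: "real^'k^'n"
  proof -
    have "flip_pvalue \<phi> X
        = (\<integral>v. indicator {v. \<phi> (emp_mean X) \<le> \<phi> (wmean v X)} v \<partial>rademacher_vec_pmf)"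
      by (simp add: flip_pvalue_def)
    also have "\<dots> = (\<Sum>v\<in>sign_vectors.
        indicator {v. \<phi> (emp_mean X) \<le> \<phi> (wmean v X)} v * pmf rademacher_vec_pmf v)"
      by (rule integral_measure_pmf_real) auto
    finally show ?thesis
      by (simp add: indicator_def)
  qed
  then have "flip_pvalue \<phi> = (\<lambda>X::real^'k^'n. \<Sum>v\<in>sign_vectors.
      indicator {X. \<phi> (emp_mean X) \<le> \<phi> (wmean v X)} X * pmf rademacher_vec_pmf v)" ..
  then show ?thesis
    by (simp only:) measurable
qed

text \<open>
  Validity of the test. By invariance, the rejection probability is its own average over all sign flips of
  the data; for each realisation of the data, the average of the rejection indicators is at most \<open>\<alpha>\<close> by
  \<open>prob_pvalue_le\<close>.
\<close>

lemma (in prob_space) prob_flip_pvalue_le: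
  fixes X :: "'a \<Rightarrow> real^'k^'n"
  assumes X [measurable]: "X \<in> borel_measurable M"
    and \<phi> [measurable]: "\<phi> \<in> borel_measurable borel"
    and inv: "\<And>w. w \<in> sign_vectors \<Longrightarrow>
        distr M borel (\<lambda>\<omega>. flip_signs w (X \<omega>)) = distr M borel X"
    and "0 \<le> \<alpha>"
  shows "prob {\<omega> \<in> space M. flip_pvalue \<phi> (X \<omega>) \<le> \<alpha>} \<le> \<alpha>"
proof -
  note [measurable] = borel_measurable_flip_pvalue[OF \<phi>]
  let ?R = "rademacher_vec_pmf :: (real^'n) pmf"
  define A where "A w = {\<omega> \<in> space M. flip_pvalue \<phi> (flip_signs w (X \<omega>)) \<le> \<alpha>}" for w
  define c where "c = prob {\<omega> \<in> space M. flip_pvalue \<phi> (X \<omega>) \<le> \<alpha>}"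
  have A [measurable]: "A w \<in> events" for w
    unfolding A_def by measurable
  have D: "{X. flip_pvalue \<phi> X \<le> \<alpha>} \<in> sets (borel :: (real^'k^'n) measure)"
    by measurable
  have probA: "prob (A w) = c" if "w \<in> sign_vectors" for w
  proof -
    have "prob (A w) = measure (distr M borel (\<lambda>\<omega>. flip_signs w (X \<omega>))) {X. flip_pvalue \<phi> X \<le> \<alpha>}"
      using D by (subst measure_distr) (auto simp: A_def intro!: arg_cong[where f = prob])
    also have "\<dots> = measure (distr M borel X) {X. flip_pvalue \<phi> X \<le> \<alpha>}"
      by (simp only: inv[OF that])
    also have "\<dots> = c"
      using D by (subst measure_distr) (auto simp: c_def intro!: arg_cong[where f = prob])
    finally show ?thesis .
  qed
  have "c = (\<Sum>w\<in>sign_vectors. c * pmf ?R w)"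
    using sum_pmf_eq_1[of "sign_vectors :: (real^'n) set" ?R]
    by (simp flip: sum_distrib_left)
  also have "\<dots> = (\<Sum>w\<in>sign_vectors. prob (A w) * pmf ?R w)"
    by (simp add: probA)
  also have "\<dots> = (\<Sum>w\<in>sign_vectors. (\<integral>\<omega>. indicator (A w) \<omega> * pmf ?R w \<partial>M))"
    by (intro sum.cong refl) (simp add: Int_absorb1 sets.sets_into_space[OF A])
  also have "\<dots> = (\<integral>\<omega>. (\<Sum>w\<in>sign_vectors. indicator (A w) \<omega> * pmf ?R w) \<partial>M)"
    by (intro Bochner_Integration.integral_sum[symmetric] integrable_mult_left
        integrable_real_indicator A) (simp add: less_top[symmetric])
  also have "\<dots> \<le> (\<integral>\<omega>. \<alpha> \<partial>M)"
  proof (rule integral_mono)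
    show "integrable M (\<lambda>\<omega>. \<Sum>w\<in>sign_vectors. indicator (A w) \<omega> * pmf ?R w)"
      by (intro Bochner_Integration.integrable_sum integrable_mult_left integrable_real_indicator A)
         (simp add: less_top[symmetric])
  next
    fix \<omega> assume \<omega>: "\<omega> \<in> space M"
    let ?g = "\<lambda>w. \<phi> (wmean w (X \<omega>))"
    let ?rej = "{w. measure_pmf.prob ?R {v. ?g w \<le> ?g v} \<le> \<alpha>}"
    have "(\<Sum>w\<in>sign_vectors. indicator (A w) \<omega> * pmf ?R w)
        = (\<Sum>w\<in>sign_vectors. indicator ?rej w * pmf ?R w)"
      using \<omega> by (intro sum.cong refl) (simp add: A_def indicator_def flip_pvalue_flip_signs)
    also have "\<dots> = (\<integral>w. indicator ?rej w \<partial>?R)"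
      by (rule integral_measure_pmf_real[symmetric]) auto
    also have "\<dots> = measure_pmf.prob ?R ?rej"
      by simp
    also have "\<dots> \<le> \<alpha>"
      using \<open>0 \<le> \<alpha>\<close> by (intro prob_pvalue_le) auto
    finally show "(\<Sum>w\<in>sign_vectors. indicator (A w) \<omega> * pmf ?R w) \<le> \<alpha>" .
  qed simp
  also have "\<dots> = \<alpha>"
    by (simp add: prob_space)
  finally show ?thesis
    by (simp add: c_def)
qed

lemma borel_measurable_vec_lambda:
  fixes X :: "'n::finite \<Rightarrow> 'a \<Rightarrow> 'b::euclidean_space"
  assumes "\<And>i. X i \<in> borel_measurable M"
  shows "(\<lambda>\<omega>. \<chi> i. X i \<omega>) \<in> borel_measurable M"
proof (rule borel_measurable_euclidean_space[THEN iffD2], rule ballI)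
  fix u :: "'b^'n" assume "u \<in> Basis"
  then obtain i b where "u = axis i b"
    by (auto simp: Basis_vec_def)
  then show "(\<lambda>\<omega>. (\<chi> i. X i \<omega>) \<bullet> u) \<in> borel_measurable M"
    using borel_measurable_inner[OF assms borel_measurable_const] by (simp add: inner_axis)
qed

text \<open>
  The joint law of independent vectors is the product of their laws, so it is determined by the marginals.
\<close>

lemma (in prob_space) distr_vec_eqI:
  fixes X X' :: "'n::finite \<Rightarrow> 'a \<Rightarrow> 'b::euclidean_space"
  assumes X: "indep_vars (\<lambda>_. borel) X UNIV" and X': "indep_vars (\<lambda>_. borel) X' UNIV"
    and eq: "\<And>i. distr M borel (X i) = distr M borel (X' i)"
  shows "distr M borel (\<lambda>\<omega>. \<chi> i. X i \<omega>) = distr M borel (\<lambda>\<omega>. \<chi> i. X' i \<omega>)"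
proof -
  let ?P = "PiM UNIV (\<lambda>_::'n. borel :: 'b measure)"
  have vec: "vec_lambda \<in> measurable ?P borel"
    using borel_measurable_vec_lambda[of "\<lambda>i x. x i" ?P] by simp
  have law: "distr M borel (\<lambda>\<omega>. \<chi> i. Z i \<omega>) = distr (PiM UNIV (\<lambda>i. distr M borel (Z i))) borel vec_lambda"
    if Z: "indep_vars (\<lambda>_. borel) Z UNIV" for Z :: "'n \<Rightarrow> 'a \<Rightarrow> 'b"
  proof -
    have [measurable]: "Z i \<in> borel_measurable M" for i
      using Z by (auto simp: indep_vars_def)
    have "distr M ?P (\<lambda>\<omega>. \<lambda>i\<in>UNIV. Z i \<omega>) = PiM UNIV (\<lambda>i. distr M borel (Z i))"
      using Z by (subst indep_vars_iff_distr_eq_PiM[symmetric]) auto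
    moreover have "distr (distr M ?P (\<lambda>\<omega>. \<lambda>i\<in>UNIV. Z i \<omega>)) borel vec_lambda
        = distr M borel (\<lambda>\<omega>. \<chi> i. Z i \<omega>)"
      by (subst distr_distr[OF vec]) (measurable, simp add: comp_def restrict_def)
    ultimately show ?thesis by simp
  qed
  show ?thesis
    unfolding law[OF X] law[OF X'] by (simp add: eq)
qed

section \<open>Effect of empirical centring\<close>

lemma wmean_diff:
  "wmean w (\<chi> i. X $ i - c) = wmean w X - ((\<Sum>i\<in>UNIV. w $ i) / real CARD('n)) *\<^sub>R c"
  for X :: "real^'k^'n"
proof -
  have "(\<Sum>i\<in>UNIV. w $ i *\<^sub>R (X $ i - c)) = (\<Sum>i\<in>UNIV. w $ i *\<^sub>R X $ i) - (\<Sum>i\<in>UNIV. w $ i) *\<^sub>R c"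
    by (simp add: scaleR_diff_right sum_subtractf scaleR_sum_left)
  then show ?thesis
    by (simp add: wmean_def scaleR_diff_right)
qed

lemma wmean_eq_wmean_centered:
  fixes X :: "real^'k^'n"
  shows "wmean w (\<chi> i. X $ i - \<mu>)
    = wmean w (centered X) + ((\<Sum>i\<in>UNIV. w $ i) / real CARD('n)) *\<^sub>R (emp_mean X - \<mu>)"
  unfolding centered_def wmean_diff by (simp add: scaleR_diff_right)

lemma emp_mean_diff: "emp_mean (\<chi> i. X $ i - \<mu>) = emp_mean X - \<mu>" for X :: "real^'k^'n"
  by (simp add: emp_mean_def sum_subtractf scaleR_diff_right sum_constant_scaleR del: sum_constant)

lemma pos_homogeneous_scaleR_le:
  assumes "pos_homogeneous \<phi>"
  shows "\<phi> (c *\<^sub>R x) \<le> \<bar>c\<bar> * sym_max \<phi> x"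
proof (cases "c \<ge> 0")
  case True
  then have "\<phi> (c *\<^sub>R x) = \<bar>c\<bar> * \<phi> x"
    using assms by (simp add: pos_homogeneous_def)
  then show ?thesis
    by (simp add: sym_max_def mult_left_mono)
next
  case False
  then have "\<phi> ((- c) *\<^sub>R (- x)) = \<bar>c\<bar> * \<phi> (- x)"
    using assms unfolding pos_homogeneous_def by (metis abs_of_neg less_le neg_0_le_iff_le not_le)
  then show ?thesis
    by (simp add: sym_max_def mult_left_mono)
qed

text \<open>A sublinear function on a finite-dimensional space is convex, hence continuous.\<close>

lemma continuous_on_sublinear:
  fixes \<phi> :: "'b::euclidean_space \<Rightarrow> real"
  assumes "subadditive_fun \<phi>" "pos_homogeneous \<phi>"
  shows "continuous_on UNIV \<phi>"
proof (rule convex_on_continuous)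
  show "convex_on UNIV \<phi>"
  proof (rule convex_onI)
    fix t x y assume "0 < t" "t < (1::real)"
    then show "\<phi> ((1 - t) *\<^sub>R x + t *\<^sub>R y) \<le> (1 - t) * \<phi> x + t * \<phi> y"
      using assms unfolding subadditive_fun_def pos_homogeneous_def
      by (metis diff_ge_0_iff_ge less_imp_le)
  qed simp
qed simp

text \<open>
  The deterministic core: where \<open>sym_max \<phi> (emp_mean X - \<mu>)\<close> is at most \<open>b\<close>, exceeding the corrected
  threshold forces a small p-value.
\<close>

lemma flip_pvalue_le_if_gt_threshold:
  fixes X :: "real^'k^'n"
  assumes nonneg: "\<And>x. \<phi> x \<ge> 0" and sub: "subadditive_fun \<phi>" and hom: "pos_homogeneous \<phi>"
    and \<alpha>: "0 \<le> \<alpha>" and "0 \<le> \<eta>"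
    and b: "sym_max \<phi> (emp_mean X - \<mu>) \<le> b"
    and gt: "\<phi> (emp_mean X - \<mu>) > resampled_quantile \<alpha> \<phi> (centered X) + gamma1 CARD('n) \<eta> * b"
  shows "flip_pvalue \<phi> (\<chi> i. X $ i - \<mu>) \<le> \<alpha> + \<eta>"
proof -
  let ?R = "measure_pmf.prob (rademacher_vec_pmf :: (real^'n) pmf)"
  let ?S = "\<chi> i. X $ i - \<mu>"
  let ?q = "resampled_quantile \<alpha> \<phi> (centered X)"
  let ?\<gamma> = "gamma1 CARD('n) \<eta>"
  define m where "m w = (\<Sum>i\<in>UNIV. w $ i) / real CARD('n)" for w :: "real^'n"
  define A where "A = {w. \<phi> (wmean w (centered X)) > ?q}"
  define B where "B = {w. \<bar>m w\<bar> > ?\<gamma>}"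
  have "b \<ge> 0"
    using b nonneg[of "emp_mean X - \<mu>"] by (simp add: sym_max_def)
  have "{w. \<phi> (emp_mean ?S) \<le> \<phi> (wmean w ?S)} \<subseteq> A \<union> B"
  proof
    fix w assume "w \<in> {w. \<phi> (emp_mean ?S) \<le> \<phi> (wmean w ?S)}"
    then have "?q + ?\<gamma> * b < \<phi> (wmean w ?S)"
      using gt by (simp add: emp_mean_diff)
    also have "\<dots> \<le> \<phi> (wmean w (centered X)) + \<phi> (m w *\<^sub>R (emp_mean X - \<mu>))"
      unfolding wmean_eq_wmean_centered m_def using sub by (simp add: subadditive_fun_def)
    also have "\<phi> (m w *\<^sub>R (emp_mean X - \<mu>)) \<le> \<bar>m w\<bar> * b"
      using pos_homogeneous_scaleR_le[OF hom] b by (meson abs_ge_zero mult_left_mono order_trans)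
    finally have *: "?q + ?\<gamma> * b < \<phi> (wmean w (centered X)) + \<bar>m w\<bar> * b"
      by simp
    show "w \<in> A \<union> B"
    proof (rule ccontr)
      assume "w \<notin> A \<union> B"
      then have "\<phi> (wmean w (centered X)) \<le> ?q" "\<bar>m w\<bar> * b \<le> ?\<gamma> * b"
        using \<open>b \<ge> 0\<close> by (auto simp: A_def B_def intro: mult_right_mono)
      with * show False by simp
    qed
  qed
  then have "flip_pvalue \<phi> ?S \<le> ?R (A \<union> B)"
    unfolding flip_pvalue_def by (intro measure_pmf.finite_measure_mono) auto
  also have "\<dots> \<le> ?R A + ?R B"
    by (rule measure_Un_le) auto
  also have "?R A \<le> \<alpha>"
    unfolding A_def using \<alpha> by (rule prob_gt_resampled_quantile_le)
  also have "?R B \<le> \<eta>"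
    unfolding B_def m_def using \<open>0 \<le> \<eta>\<close> by (rule prob_abs_mean_sign_gt_gamma1)
  finally show ?thesis by simp
qed

section \<open>The bound for the resampled quantile\<close>

theorem theorem3p2:
  fixes M :: "'a measure"
    and Y :: "'a \<Rightarrow> real^'k^'n"
    and \<mu> :: "real^'k"
    and f :: "real^'k^'n \<Rightarrow> real"
    and \<phi> :: "real^'k \<Rightarrow> real"
    and \<delta> \<alpha>\<^sub>0 :: real
  assumes n_ge_2: "CARD('n) \<ge> 2"
    and delta: "0 < \<delta>" "\<delta> < 1"
    and alpha0: "0 < \<alpha>\<^sub>0" "\<alpha>\<^sub>0 < 1"
    and M: "prob_space M"
    and indep: "prob_space.indep_vars M (\<lambda>_. borel) (\<lambda>i \<omega>. Y \<omega> $ i) UNIV"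
    and ident: "\<And>i j. distr M borel (\<lambda>\<omega>. Y \<omega> $ i) = distr M borel (\<lambda>\<omega>. Y \<omega> $ j)"
    and integrable: "\<And>i. integrable M (\<lambda>\<omega>. Y \<omega> $ i)"
    and mean: "\<And>i. (\<integral>\<omega>. Y \<omega> $ i \<partial>M) = \<mu>"
    and symmetric: "\<And>i. distr M borel (\<lambda>\<omega>. Y \<omega> $ i - \<mu>) = distr M borel (\<lambda>\<omega>. \<mu> - Y \<omega> $ i)"
    and f_nonneg: "\<And>y. f y \<ge> 0"
    and f_meas: "(\<lambda>\<omega>. f (Y \<omega>)) \<in> borel_measurable M"
    and phi_nonneg: "\<And>x. \<phi> x \<ge> 0"
    and phi_subadd: "subadditive_fun \<phi>"
    and phi_hom: "pos_homogeneous \<phi>"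
  shows "\<P>(\<omega> in M. \<phi> (emp_mean (Y \<omega>) - \<mu>) >
             resampled_quantile (\<alpha>\<^sub>0 * (1 - \<delta>)) \<phi> (centered (Y \<omega>))
             + gamma1 CARD('n) (\<alpha>\<^sub>0 * \<delta>) * f (Y \<omega>))
         \<le> \<alpha>\<^sub>0 + \<P>(\<omega> in M. sym_max \<phi> (emp_mean (Y \<omega>) - \<mu>) > f (Y \<omega>))"
proof -
  interpret prob_space M by (rule M)
  note [measurable] = f_meas
  have Yi [measurable]: "(\<lambda>\<omega>. Y \<omega> $ i) \<in> borel_measurable M" for i
    using indep by (auto simp: indep_vars_def)
  have Y [measurable]: "Y \<in> borel_measurable M"
    using borel_measurable_vec_lambda[of "\<lambda>i \<omega>. Y \<omega> $ i"] Yi by simp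
  have \<phi> [measurable]: "\<phi> \<in> borel_measurable borel"
    using continuous_on_sublinear[OF phi_subadd phi_hom] by (rule borel_measurable_continuous_onI)
  note [measurable] = borel_measurable_flip_pvalue[OF \<phi>]
  define S where "S \<omega> = (\<chi> i. Y \<omega> $ i - \<mu>)" for \<omega>
  have S [measurable]: "S \<in> borel_measurable M"
    unfolding S_def by (intro borel_measurable_vec_lambda) measurable
  have flip: "distr M borel (\<lambda>\<omega>. flip_signs w (S \<omega>)) = distr M borel S"
    if w: "w \<in> sign_vectors" for w
  proof -
    have "distr M borel (\<lambda>\<omega>. \<chi> i. w $ i *\<^sub>R (Y \<omega> $ i - \<mu>)) = distr M borel (\<lambda>\<omega>. \<chi> i. Y \<omega> $ i - \<mu>)"
    proof (rule distr_vec_eqI)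
      show "indep_vars (\<lambda>_. borel) (\<lambda>i \<omega>. w $ i *\<^sub>R (Y \<omega> $ i - \<mu>)) UNIV"
        by (rule indep_vars_compose2[OF indep, where Y = "\<lambda>i y. w $ i *\<^sub>R (y - \<mu>)"]) measurable
      show "indep_vars (\<lambda>_. borel) (\<lambda>i \<omega>. Y \<omega> $ i - \<mu>) UNIV"
        by (rule indep_vars_compose2[OF indep, where Y = "\<lambda>i y. y - \<mu>"]) measurable
      show "distr M borel (\<lambda>\<omega>. w $ i *\<^sub>R (Y \<omega> $ i - \<mu>)) = distr M borel (\<lambda>\<omega>. Y \<omega> $ i - \<mu>)" for i
      proof -
        have "w $ i = 1 \<or> w $ i = - 1"
          using w by (auto simp: sign_vectors_def)
        then show ?thesis
          by (auto simp: symmetric)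
      qed
    qed
    then show ?thesis
      by (simp add: flip_signs_def S_def[abs_def])
  qed
  let ?rej = "{\<omega> \<in> space M. flip_pvalue \<phi> (S \<omega>) \<le> \<alpha>\<^sub>0}"
  let ?exc = "{\<omega> \<in> space M. sym_max \<phi> (emp_mean (Y \<omega>) - \<mu>) > f (Y \<omega>)}"
  have rej: "?rej \<in> events"
    by measurable
  have exc: "?exc \<in> events"
    unfolding sym_max_def by measurable
  have level: "0 \<le> \<alpha>\<^sub>0 * (1 - \<delta>)" "0 \<le> \<alpha>\<^sub>0 * \<delta>"
    using delta alpha0 by auto
  have "\<P>(\<omega> in M. \<phi> (emp_mean (Y \<omega>) - \<mu>) >
             resampled_quantile (\<alpha>\<^sub>0 * (1 - \<delta>)) \<phi> (centered (Y \<omega>))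
             + gamma1 CARD('n) (\<alpha>\<^sub>0 * \<delta>) * f (Y \<omega>)) \<le> prob (?rej \<union> ?exc)"
  proof (rule finite_measure_mono)
    show "{\<omega> \<in> space M. \<phi> (emp_mean (Y \<omega>) - \<mu>) >
             resampled_quantile (\<alpha>\<^sub>0 * (1 - \<delta>)) \<phi> (centered (Y \<omega>))
             + gamma1 CARD('n) (\<alpha>\<^sub>0 * \<delta>) * f (Y \<omega>)} \<subseteq> ?rej \<union> ?exc"
    proof safe
      fix \<omega> assume "\<not> f (Y \<omega>) < sym_max \<phi> (emp_mean (Y \<omega>) - \<mu>)"
        and "\<phi> (emp_mean (Y \<omega>) - \<mu>) > resampled_quantile (\<alpha>\<^sub>0 * (1 - \<delta>)) \<phi> (centered (Y \<omega>))
             + gamma1 CARD('n) (\<alpha>\<^sub>0 * \<delta>) * f (Y \<omega>)"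
      then have "flip_pvalue \<phi> (S \<omega>) \<le> \<alpha>\<^sub>0 * (1 - \<delta>) + \<alpha>\<^sub>0 * \<delta>"
        unfolding S_def
        by (intro flip_pvalue_le_if_gt_threshold[OF phi_nonneg phi_subadd phi_hom level]) auto
      then show "flip_pvalue \<phi> (S \<omega>) \<le> \<alpha>\<^sub>0"
        by (simp add: algebra_simps)
    qed
    show "?rej \<union> ?exc \<in> events"
      using rej exc by auto
  qed
  also have "\<dots> \<le> prob ?rej + prob ?exc"
    using rej exc by (rule measure_Un_le)
  also have "prob ?rej \<le> \<alpha>\<^sub>0"
    using flip alpha0 by (intro prob_flip_pvalue_le) auto
  finally show ?thesis
    by simp
qed

end
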